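(* Let $M$ be a von Neumann algebra, $(N_t)_{t\in[0,T]}$ an increasing family of abelian von Neumann subalgebras of $M$, and $\psi$ a faithful normal state on $M$ such that, for every $t\in[0,T]$, $\sigma_s^\psi(N_t)=N_t$ for all $s\in\mathbb R$. For each $t$ let $E_t^\psi:M\to N_t$ be the unique normal $\psi$-preserving conditional expectation. Then for all $0\le s\le t\le T$, $$E_s^\psi\circ E_t^\psi=E_s^\psi .$$
   Context: $(\sigma_s^\psi)_{s\in\mathbb R}$ is the modular automorphism group of the faithful normal state $\psi$. A conditional expectation of $M$ onto a von Neumann subalgebra $N$ is a norm-one linear projection of $M$ onto $N$ (automatically unital, completely positive and $N$-bimodular); it is $\psi$-preserving if $\psi\circ E=\psi$. Under the invariance hypothesis, Takesaki's theorem gives existence and uniqueness of $E_t^\psi$. *)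

theory Defs
  imports "HOL-Analysis.Analysis"
begin

section \<open>Complex Hilbert spaces and their bounded operators\<close>

text \<open>The inner product is linear in the second argument. Positivity, definiteness and the norm are
  inherited from \<^class>\<open>real_inner\<close>, whose inner product is the real part.\<close>

class complex_hilbert_space = real_inner + complete_space +
  fixes scaleC :: "complex \<Rightarrow> 'a \<Rightarrow> 'a" (infixr "*\<^sub>C" 75)
    and cinner :: "'a \<Rightarrow> 'a \<Rightarrow> complex"
  assumes scaleC_add_right: "a *\<^sub>C (x + y) = a *\<^sub>C x + a *\<^sub>C y"
    and scaleC_add_left: "(a + b) *\<^sub>C x = a *\<^sub>C x + b *\<^sub>C x"
    and scaleC_scaleC: "a *\<^sub>C (b *\<^sub>C x) = (a * b) *\<^sub>C x"
    and scaleC_of_real: "complex_of_real r *\<^sub>C x = r *\<^sub>R x"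
    and cinner_commute: "cinner x y = cnj (cinner y x)"
    and cinner_add_right: "cinner x (y + z) = cinner x y + cinner x z"
    and cinner_scaleC_right: "cinner x (a *\<^sub>C y) = a * cinner x y"
    and Re_cinner: "Re (cinner x y) = inner x y"

lemma norm_scaleC: "norm (c *\<^sub>C x) = cmod c * norm x"
  for x :: "'a::complex_hilbert_space"
proof -
  have l: "cinner (c *\<^sub>C x) (c *\<^sub>C x) = c * cnj c * cinner x x"
    by (metis cinner_commute cinner_scaleC_right complex_cnj_mult mult.assoc)
  have "Im (cinner x x) = 0"
    using cinner_commute[of x x] by (metis cnj.sel(2) equal_neg_zero)
  then have "inner (c *\<^sub>C x) (c *\<^sub>C x) = (cmod c)\<^sup>2 * inner x x"
    unfolding Re_cinner[symmetric] l complex_norm_square[symmetric] by simp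
  then have "(norm (c *\<^sub>C x))\<^sup>2 = (cmod c * norm x)\<^sup>2"
    by (simp add: power2_norm_eq_inner power_mult_distrib)
  then show ?thesis
    by (simp add: power2_eq_iff_nonneg)
qed

text \<open>Bounded operators are elements of the real type of bounded linear maps, restricted to
  the complex-linear ones; the operator norm is the same.\<close>

type_synonym 'h operator = "'h \<Rightarrow>\<^sub>L 'h"

definition bounded_ops :: "'h::complex_hilbert_space operator set" where
  "bounded_ops = {T. \<forall>c \<xi>. blinfun_apply T (c *\<^sub>C \<xi>) = c *\<^sub>C blinfun_apply T \<xi>}"

lift_definition scaleC_op :: "complex \<Rightarrow> 'h::complex_hilbert_space operator \<Rightarrow> 'h operator"
  is "\<lambda>c T \<xi>. c *\<^sub>C T \<xi>"
proof -
  fix c :: complex and T :: "'h \<Rightarrow> 'h"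
  assume T: "bounded_linear T"
  have "bounded_linear (\<lambda>\<xi>::'h. c *\<^sub>C \<xi>)"
    by (rule bounded_linear_intro[where K = "cmod c"])
      (simp_all add: scaleC_add_right norm_scaleC mult.commute scaleC_scaleC
        flip: scaleC_of_real)
  from bounded_linear_compose[OF this T] show "bounded_linear (\<lambda>\<xi>. c *\<^sub>C T \<xi>)" .
qed

definition adj :: "'h::complex_hilbert_space operator \<Rightarrow> 'h operator" where
  "adj T = (THE S. \<forall>\<xi> \<eta>. cinner (blinfun_apply T \<xi>) \<eta> = cinner \<xi> (blinfun_apply S \<eta>))"

definition op_le :: "'h::complex_hilbert_space operator \<Rightarrow> 'h operator \<Rightarrow> bool" where
  "op_le S T \<longleftrightarrow> (\<forall>\<xi>. cinner \<xi> (blinfun_apply (T - S) \<xi>) \<in> \<real> \<and>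
                     0 \<le> Re (cinner \<xi> (blinfun_apply (T - S) \<xi>)))"


section \<open>Von Neumann algebras\<close>

definition commutant :: "'h::complex_hilbert_space operator set \<Rightarrow> 'h operator set" where
  "commutant A = {T \<in> bounded_ops. \<forall>a\<in>A. T o\<^sub>L a = a o\<^sub>L T}"

definition von_neumann_algebra :: "'h::complex_hilbert_space operator set \<Rightarrow> bool" where
  "von_neumann_algebra M \<longleftrightarrow>
     M \<subseteq> bounded_ops \<and> (\<forall>x\<in>M. adj x \<in> M) \<and> commutant (commutant M) = M"

definition von_neumann_subalgebra ::
    "'h::complex_hilbert_space operator set \<Rightarrow> 'h operator set \<Rightarrow> bool" where
  "von_neumann_subalgebra N M \<longleftrightarrow> von_neumann_algebra N \<and> N \<subseteq> M"

definition abelian :: "'h::complex_hilbert_space operator set \<Rightarrow> bool" where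
  "abelian N \<longleftrightarrow> (\<forall>x\<in>N. \<forall>y\<in>N. x o\<^sub>L y = y o\<^sub>L x)"


section \<open>Normality, states, conditional expectations\<close>

text \<open>Normality is preservation of suprema of bounded increasing nets of self-adjoint elements,
  with such nets rendered as upward directed sets.\<close>

definition directed_sa :: "'h::complex_hilbert_space operator set \<Rightarrow> bool" where
  "directed_sa D \<longleftrightarrow> D \<noteq> {} \<and> (\<forall>a\<in>D. adj a = a) \<and>
     (\<forall>a\<in>D. \<forall>b\<in>D. \<exists>c\<in>D. op_le a c \<and> op_le b c)"

definition is_sup_in ::
    "'h::complex_hilbert_space operator set \<Rightarrow> 'h operator set \<Rightarrow> 'h operator \<Rightarrow> bool" where
  "is_sup_in M D x \<longleftrightarrow> x \<in> M \<and> (\<forall>d\<in>D. op_le d x) \<and>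
     (\<forall>u\<in>M. (\<forall>d\<in>D. op_le d u) \<longrightarrow> op_le x u)"

definition clinear_on ::
    "'h::complex_hilbert_space operator set \<Rightarrow> ('h operator \<Rightarrow> 'b::ab_group_add) \<Rightarrow>
     (complex \<Rightarrow> 'b \<Rightarrow> 'b) \<Rightarrow> bool" where
  "clinear_on M f sc \<longleftrightarrow>
     (\<forall>x\<in>M. \<forall>y\<in>M. f (x + y) = f x + f y) \<and>
     (\<forall>c. \<forall>x\<in>M. f (scaleC_op c x) = sc c (f x))"

definition state :: "'h::complex_hilbert_space operator set \<Rightarrow> ('h operator \<Rightarrow> complex) \<Rightarrow> bool" where
  "state M \<psi> \<longleftrightarrow> clinear_on M \<psi> (*) \<and>
     (\<forall>x\<in>M. \<psi> (adj x o\<^sub>L x) \<in> \<real> \<and> 0 \<le> Re (\<psi> (adj x o\<^sub>L x))) \<and>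
     \<psi> id_blinfun = 1"

definition faithful :: "'h::complex_hilbert_space operator set \<Rightarrow> ('h operator \<Rightarrow> complex) \<Rightarrow> bool" where
  "faithful M \<psi> \<longleftrightarrow> (\<forall>x\<in>M. \<psi> (adj x o\<^sub>L x) = 0 \<longrightarrow> x = 0)"

definition normal_functional ::
    "'h::complex_hilbert_space operator set \<Rightarrow> ('h operator \<Rightarrow> complex) \<Rightarrow> bool" where
  "normal_functional M \<psi> \<longleftrightarrow>
     (\<forall>D x. D \<subseteq> M \<and> directed_sa D \<and> is_sup_in M D x \<longrightarrow>
        bdd_above ((\<lambda>d. Re (\<psi> d)) ` D) \<and> Re (\<psi> x) = (SUP d\<in>D. Re (\<psi> d)))"

definition normal_map ::
    "'h::complex_hilbert_space operator set \<Rightarrow> 'h operator set \<Rightarrow> ('h operator \<Rightarrow> 'h operator) \<Rightarrow> bool" where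
  "normal_map M N E \<longleftrightarrow>
     (\<forall>D x. D \<subseteq> M \<and> directed_sa D \<and> is_sup_in M D x \<longrightarrow> is_sup_in N (E ` D) (E x))"

text \<open>Since \<open>N\<close> contains the identity and \<open>E\<close> fixes \<open>N\<close>, contractivity means that \<open>E\<close> has
  norm exactly one (the Hilbert space is nonzero as soon as \<open>M\<close> carries a state).\<close>

definition conditional_expectation ::
    "'h::complex_hilbert_space operator set \<Rightarrow> 'h operator set \<Rightarrow> ('h operator \<Rightarrow> 'h operator) \<Rightarrow> bool" where
  "conditional_expectation M N E \<longleftrightarrow>
     clinear_on M E scaleC_op \<and> E ` M \<subseteq> N \<and> (\<forall>x\<in>N. E x = x) \<and> (\<forall>x\<in>M. norm (E x) \<le> norm x)"

definition preserving ::
    "'h::complex_hilbert_space operator set \<Rightarrow> ('h operator \<Rightarrow> complex) \<Rightarrow> ('h operator \<Rightarrow> 'h operator) \<Rightarrow> bool" where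
  "preserving M \<psi> E \<longleftrightarrow> (\<forall>x\<in>M. \<psi> (E x) = \<psi> x)"


section \<open>The modular automorphism group\<close>

definition gns_triple ::
    "'h::complex_hilbert_space operator set \<Rightarrow> ('h operator \<Rightarrow> complex) \<Rightarrow>
     ('h operator \<Rightarrow> 'k::complex_hilbert_space operator) \<Rightarrow> 'k \<Rightarrow> bool" where
  "gns_triple M \<psi> \<pi> \<Omega> \<longleftrightarrow>
     \<pi> ` M \<subseteq> bounded_ops \<and> clinear_on M \<pi> scaleC_op \<and> \<pi> id_blinfun = id_blinfun \<and>
     (\<forall>x\<in>M. \<forall>y\<in>M. \<pi> (x o\<^sub>L y) = \<pi> x o\<^sub>L \<pi> y) \<and> (\<forall>x\<in>M. \<pi> (adj x) = adj (\<pi> x)) \<and>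
     (\<forall>x\<in>M. \<psi> x = cinner \<Omega> (blinfun_apply (\<pi> x) \<Omega>)) \<and>
     closure ((\<lambda>x. blinfun_apply (\<pi> x) \<Omega>) ` M) = UNIV"

text \<open>Unbounded operators are given by their graphs. \<open>tomita_op\<close> is the Tomita operator \<open>S\<close>, the
  closure of \<open>\<pi>(x) \<Omega> \<mapsto> \<pi>(x\<^sup>*) \<Omega>\<close>. It is antilinear, so its adjoint satisfies
  \<open>\<langle>S \<xi>, \<eta>\<rangle> = \<langle>S\<^sup>* \<eta>, \<xi>\<rangle>\<close>. The modular operator is \<open>\<Delta> = S\<^sup>* S\<close>.\<close>

definition tomita_op ::
    "'h::complex_hilbert_space operator set \<Rightarrow> ('h operator \<Rightarrow> 'k::complex_hilbert_space operator) \<Rightarrow>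
     'k \<Rightarrow> ('k \<times> 'k) set" where
  "tomita_op M \<pi> \<Omega> =
     closure {(blinfun_apply (\<pi> x) \<Omega>, blinfun_apply (\<pi> (adj x)) \<Omega>) | x. x \<in> M}"

definition antilinear_adj :: "('k::complex_hilbert_space \<times> 'k) set \<Rightarrow> ('k \<times> 'k) set" where
  "antilinear_adj S = {(\<eta>, \<zeta>). \<forall>(\<xi>, \<xi>') \<in> S. cinner \<xi>' \<eta> = cinner \<zeta> \<xi>}"

definition modular_operator ::
    "'h::complex_hilbert_space operator set \<Rightarrow> ('h operator \<Rightarrow> 'k::complex_hilbert_space operator) \<Rightarrow>
     'k \<Rightarrow> ('k \<times> 'k) set" where
  "modular_operator M \<pi> \<Omega> = tomita_op M \<pi> \<Omega> O antilinear_adj (tomita_op M \<pi> \<Omega>)"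

definition spectral_measure :: "(real set \<Rightarrow> 'k::complex_hilbert_space operator) \<Rightarrow> bool" where
  "spectral_measure P \<longleftrightarrow>
     (\<forall>B\<in>sets borel. P B \<in> bounded_ops \<and> P B o\<^sub>L P B = P B \<and> adj (P B) = P B) \<and>
     P UNIV = id_blinfun \<and>
     (\<forall>B. range B \<subseteq> sets borel \<and> disjoint_family B \<longrightarrow>
        (\<forall>\<xi>. (\<lambda>n::nat. blinfun_apply (P (B n)) \<xi>) sums blinfun_apply (P (\<Union>n. B n)) \<xi>))"

text \<open>The measure \<open>B \<mapsto> \<langle>\<xi>, P(B) \<xi>\<rangle> = \<parallel>P(B) \<xi>\<parallel>\<^sup>2\<close>.\<close>

definition scalar_measure ::
    "(real set \<Rightarrow> 'k::complex_hilbert_space operator) \<Rightarrow> 'k \<Rightarrow> real measure" where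
  "scalar_measure P \<xi> =
     measure_of UNIV (sets borel) (\<lambda>B. ennreal ((norm (blinfun_apply (P B) \<xi>))\<^sup>2))"

text \<open>\<open>A = \<integral> \<lambda> dP(\<lambda>)\<close> for a linear operator with graph \<open>A\<close>. By polarization the quadratic
  form on the (dense) domain determines \<open>A\<close>.\<close>

definition spectral_resolution ::
    "('k::complex_hilbert_space \<times> 'k) set \<Rightarrow> (real set \<Rightarrow> 'k operator) \<Rightarrow> bool" where
  "spectral_resolution A P \<longleftrightarrow> spectral_measure P \<and>
     Domain A = {\<xi>. integrable (scalar_measure P \<xi>) (\<lambda>l. l\<^sup>2)} \<and>
     (\<forall>(\<xi>, \<zeta>)\<in>A. cinner \<xi> \<zeta> = complex_of_real (LINT l|scalar_measure P \<xi>. l))"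

text \<open>\<open>A\<^sup>i\<^sup>s = \<integral> \<lambda>\<^sup>i\<^sup>s dP(\<lambda>)\<close> for an injective positive self-adjoint operator with graph \<open>A\<close>.\<close>

definition imaginary_power ::
    "('k::complex_hilbert_space \<times> 'k) set \<Rightarrow> real \<Rightarrow> 'k operator" where
  "imaginary_power A s = (THE U. U \<in> bounded_ops \<and>
     (\<exists>P. spectral_resolution A P \<and>
        (\<forall>\<xi>. cinner \<xi> (blinfun_apply U \<xi>) =
              (LINT l|scalar_measure P \<xi>. complex_of_real l powr (\<i> * complex_of_real s)))))"

text \<open>\<open>\<sigma>\<^sub>s(x) = \<pi>\<^sup>-\<^sup>1(\<Delta>\<^sup>i\<^sup>s \<pi>(x) \<Delta>\<^sup>-\<^sup>i\<^sup>s)\<close>, where \<open>(\<pi>, \<Omega>)\<close> is a GNS representation of the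
  faithful normal state; the result does not depend on the choice of the representation.\<close>

definition modular_automorphism ::
    "'h::complex_hilbert_space operator set \<Rightarrow> ('h operator \<Rightarrow> 'k::complex_hilbert_space operator) \<Rightarrow>
     'k \<Rightarrow> real \<Rightarrow> 'h operator \<Rightarrow> 'h operator" where
  "modular_automorphism M \<pi> \<Omega> s x = (THE y. y \<in> M \<and>
     \<pi> y = imaginary_power (modular_operator M \<pi> \<Omega>) s o\<^sub>L \<pi> x o\<^sub>L
           imaginary_power (modular_operator M \<pi> \<Omega>) (- s))"

end

theory Submission
  imports Defs
begin

text \<open>Contractivity makes a conditional expectation \<open>E\<close> onto an abelian \<open>N\<close> positive, and Kadison's
  inequality \<open>E(x)\<^sup>2 \<le> E(x\<^sup>2)\<close> for self-adjoint \<open>x\<close> follows by averaging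
  \<open>0 \<le> E((x - r)\<^sup>2) = E(x\<^sup>2) - E(x)\<^sup>2 + (E(x) - r)\<^sup>2\<close> over the values \<open>r\<close> of a random walk with mean
  \<open>E(x)\<close> and small variance. Since \<open>\<psi> \<circ> E = \<psi>\<close>, \<open>E\<close> is then a contractive idempotent, hence an orthogonal
  projection, for the real inner product \<open>Re \<psi>(xy + yx) / 2\<close> on self-adjoint elements. For
  \<open>a = E\<^sub>s(E\<^sub>t x) - E\<^sub>s x \<in> N\<^sub>s\<close> the identity
  \<open>a = (x - E\<^sub>s x) - (x - E\<^sub>t x) - (E\<^sub>t x - E\<^sub>s(E\<^sub>t x))\<close> exhibits \<open>a\<close> as orthogonal to itself, so
  \<open>\<psi>(a\<^sup>2) = 0\<close> and \<open>a = 0\<close> by faithfulness.\<close>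

\<comment> \<open>Makes the space of operators complete, as the fixed-point construction of square
  roots requires.\<close>
subclass (in complex_hilbert_space) banach ..

section \<open>Adjoints\<close>

lemma linear_term_zero:
  fixes b c :: real
  assumes "\<And>t. 0 \<le> t * b + c"
  shows "b = 0"
proof (rule ccontr)
  assume "b \<noteq> 0"
  then show False
    \<comment> \<open>At this \<open>t\<close> the expression equals -1.\<close>
    using assms[of "- (c + 1) / b"] by simp
qed

lemma quadratic_linear_term_zero:
  fixes b c :: real
  assumes "\<And>t. 0 \<le> t * b + t\<^sup>2 * c"
  shows "b = 0"
proof (rule ccontr)
  assume b: "b \<noteq> 0"
  \<comment> \<open>The factor \<open>s\<close> keeps \<open>s * c\<close> below 1, so at
    \<open>t = - (s * b)\<close> the linear term beats the quadratic one.\<close>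
  define s where "s = 1 / (\<bar>c\<bar> + 1)"
  have s: "s > 0" "s * c < 1"
    by (auto simp: s_def field_simps)
  have "0 \<le> (- (s * b)) * b + (- (s * b))\<^sup>2 * c"
    by (rule assms)
  also have "\<dots> = - (s * b\<^sup>2 * (1 - s * c))"
    by (simp add: power2_eq_square algebra_simps)
  also have "\<dots> < 0"
    using s b by (simp add: mult_pos_pos)
  finally show False by simp
qed

text \<open>The vector \<open>y\<close> minimises \<open>g x = (norm x)\<^sup>2 - 2 * f x\<close>.
  Completing the square bounds \<open>g\<close> below, the parallelogram law makes a minimising
  sequence Cauchy, and the first variation vanishes at the minimum.\<close>

lemma riesz_representation:
  fixes f :: "'a::{real_inner,complete_space} \<Rightarrow> real"
  assumes "bounded_linear f"
  shows "\<exists>y. \<forall>x. f x = inner y x"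
proof -
  interpret f: bounded_linear f by fact
  define g where "g x = (norm x)\<^sup>2 - 2 * f x" for x
  obtain K where K: "\<And>x. norm (f x) \<le> norm x * K"
    using f.bounded by blast
  have "- K\<^sup>2 \<le> g x" for x
  proof -
    have "0 \<le> (norm x - K)\<^sup>2" by simp
    moreover have "f x \<le> norm x * K" using K[of x] by simp
    ultimately show ?thesis by (simp add: g_def power2_eq_square algebra_simps)
  qed
  then have bdd: "bdd_below (range g)" by (rule bdd_belowI2)
  define m where "m = Inf (range g)"
  have m_le: "m \<le> g x" for x
    unfolding m_def by (rule cInf_lower[OF _ bdd]) simp
  have "\<exists>x. g x < m + inverse (real (Suc n))" for n
    using cInf_less_iff[OF _ bdd, of "m + inverse (real (Suc n))"] by (auto simp: m_def)
  then obtain u where u: "\<And>n. g (u n) < m + inverse (real (Suc n))" by metis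
  have para: "(norm (x - y))\<^sup>2 = 2 * (g x + g y - 2 * g ((1/2) *\<^sub>R (x + y)))" for x y
    unfolding g_def power2_norm_eq_inner
    by (simp add: f.scaleR f.add inner_diff_left inner_diff_right inner_add_left inner_add_right
        inner_commute field_simps)
  have "Cauchy u"
  proof (rule CauchyI)
    fix e :: real assume e: "0 < e"
    \<comment> \<open>Two values of \<open>g\<close> within \<open>e\<^sup>2 / 4\<close> of the
      infimum give, through \<open>para\<close>, a squared distance below
      \<open>e\<^sup>2\<close>.\<close>
    then obtain N where N: "inverse (real (Suc N)) < e\<^sup>2 / 4"
      using reals_Archimedean[of "e\<^sup>2 / 4"] by auto
    show "\<exists>N. \<forall>i\<ge>N. \<forall>j\<ge>N. norm (u i - u j) < e"
    proof (intro exI allI impI)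
      fix i j assume "i \<ge> N" "j \<ge> N"
      then have "inverse (real (Suc i)) \<le> inverse (real (Suc N))"
        "inverse (real (Suc j)) \<le> inverse (real (Suc N))"
        by (auto intro!: le_imp_inverse_le)
      then have "g (u i) < m + e\<^sup>2 / 4" "g (u j) < m + e\<^sup>2 / 4"
        using u[of i] u[of j] N by linarith+
      then have "(norm (u i - u j))\<^sup>2 < e\<^sup>2"
        using m_le[of "(1/2) *\<^sub>R (u i + u j)"] para[of "u i" "u j"]
        by (simp only: mult_2 distrib_left right_diff_distrib)
      then show "norm (u i - u j) < e"
        using e by (simp add: power_less_imp_less_base)
    qed
  qed
  then obtain y where y: "u \<longlonglongrightarrow> y"
    using Cauchy_convergent_iff convergent_def by blast
  have "(\<lambda>n. g (u n)) \<longlonglongrightarrow> g y"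
    unfolding g_def by (intro tendsto_intros f.tendsto y)
  moreover have "(\<lambda>n. m + inverse (real (Suc n))) \<longlonglongrightarrow> m"
    using tendsto_add[OF tendsto_const LIMSEQ_inverse_real_of_nat, of m] by simp
  ultimately have "g y \<le> m"
    using u by (intro LIMSEQ_le) (auto intro: less_imp_le)
  then have min: "g y \<le> g x" for x using m_le[of x] by simp
  have "f x = inner y x" for x
  proof -
    have "2 * (inner y x - f x) = 0"
    proof (rule quadratic_linear_term_zero)
      fix t :: real
      have "0 \<le> g (y + t *\<^sub>R x) - g y" using min by simp
      also have "\<dots> = t * (2 * (inner y x - f x)) + t\<^sup>2 * (norm x)\<^sup>2"
        unfolding g_def power2_norm_eq_inner
        by (simp add: f.scaleR f.add inner_add_left inner_add_right inner_commute
            power2_eq_square algebra_simps)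
      finally show "0 \<le> t * (2 * (inner y x - f x)) + t\<^sup>2 * (norm x)\<^sup>2" .
    qed
    then show ?thesis by simp
  qed
  then show ?thesis by blast
qed

text \<open>Riesz yields \<open>S y\<close> pointwise; the bound on \<open>S\<close> comes from
  testing the adjoint identity at \<open>S x\<close> itself.\<close>

lemma real_adjoint_exists:
  fixes T :: "'a::{real_inner,complete_space} \<Rightarrow>\<^sub>L 'a"
  shows "\<exists>S :: 'a \<Rightarrow>\<^sub>L 'a. \<forall>x y. inner (T x) y = inner x (S y)"
proof -
  have "\<exists>z. \<forall>x. inner (T x) y = inner x z" for y
    using riesz_representation[of "\<lambda>x. inner (T x) y"]
    by (metis bounded_linear_inner_left_comp blinfun.bounded_linear_right inner_commute)
  then obtain S where S: "\<And>x y. inner (T x) y = inner x (S y)" by metis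
  have eq: "a = b" if "\<And>x. inner x a = inner x b" for a b :: 'a
    using that vector_eq_ldot by blast
  have "bounded_linear S"
  proof (rule bounded_linear_intro[where K = "norm T"])
    show "S (x + y) = S x + S y" for x y
      by (rule eq) (simp add: S[symmetric] inner_add_right)
    show "S (r *\<^sub>R x) = r *\<^sub>R S x" for r x
      by (rule eq) (simp add: S[symmetric])
    show "norm (S x) \<le> norm x * norm T" for x
    proof (cases "S x = 0")
      case False
      have "norm (S x) * norm (S x) = inner (T (S x)) x"
        by (simp add: S dot_square_norm power2_eq_square)
      also have "\<dots> \<le> norm (T (S x)) * norm x" by (rule norm_cauchy_schwarz)
      also have "\<dots> \<le> norm T * norm (S x) * norm x"
        by (intro mult_right_mono norm_blinfun) simp
      finally show ?thesis using False by (simp add: mult_ac)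
    qed simp
  qed
  then have "blinfun_apply (Blinfun S) = S" by (rule bounded_linear_Blinfun_apply)
  then show ?thesis using S by (intro exI[of _ "Blinfun S"]) simp
qed

section \<open>The complex structure seen through the real inner product\<close>

lemma scaleC_minus_one: "(-1) *\<^sub>C x = - x" for x :: "'a::complex_hilbert_space"
  using scaleC_of_real[of "-1" x] by simp

lemma scaleC_real_commute: "c *\<^sub>C (r *\<^sub>R x) = r *\<^sub>R (c *\<^sub>C x)" for x :: "'a::complex_hilbert_space"
  by (simp add: scaleC_scaleC mult.commute flip: scaleC_of_real)

lemma scaleC_ii_ii: "\<i> *\<^sub>C (\<i> *\<^sub>C x) = - x" for x :: "'a::complex_hilbert_space"
  by (simp add: scaleC_scaleC scaleC_minus_one)

lemma scaleC_Re_Im: "c *\<^sub>C x = Re c *\<^sub>R x + Im c *\<^sub>R (\<i> *\<^sub>C x)" for x :: "'a::complex_hilbert_space"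
proof -
  have "c *\<^sub>C x = (complex_of_real (Re c) + complex_of_real (Im c) * \<i>) *\<^sub>C x"
    using complex_eq[of c] by (simp add: mult.commute)
  then show ?thesis
    by (simp only: scaleC_add_left scaleC_scaleC[symmetric] scaleC_of_real)
qed

lemma Im_cinner: "Im (cinner x y) = - inner x (\<i> *\<^sub>C y)"
  by (simp add: cinner_scaleC_right flip: Re_cinner)

lemma inner_ii_left: "inner (\<i> *\<^sub>C x) y = - inner x (\<i> *\<^sub>C y)" for x y :: "'a::complex_hilbert_space"
proof -
  have "cinner (\<i> *\<^sub>C x) y = cnj (\<i> * cinner y x)"
    by (metis cinner_commute cinner_scaleC_right)
  then have "Re (cinner (\<i> *\<^sub>C x) y) = - Im (cinner y x)" by simp
  also have "\<dots> = Im (cinner x y)" using cinner_commute[of y x] by simp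
  finally show ?thesis by (simp add: Re_cinner Im_cinner)
qed

lemma bounded_opsI:
  fixes T :: "'h::complex_hilbert_space operator"
  assumes "\<And>x. T (\<i> *\<^sub>C x) = \<i> *\<^sub>C T x"
  shows "T \<in> bounded_ops"
  unfolding bounded_ops_def mem_Collect_eq
proof (intro allI)
  fix c x
  show "T (c *\<^sub>C x) = c *\<^sub>C T x"
    by (subst (1 2) scaleC_Re_Im) (simp add: blinfun.bilinear_simps assms)
qed

lemma bounded_opsD: "T \<in> bounded_ops \<Longrightarrow> T (c *\<^sub>C x) = c *\<^sub>C T x"
  by (simp add: bounded_ops_def)

text \<open>Real adjoints suffice: \<open>S\<close> inherits complex linearity from
  \<open>T\<close>, and the imaginary part of \<open>cinner x y\<close> is a real inner product with
  \<open>\<i> *\<^sub>C y\<close>, so the real identity determines the complex one.\<close>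

lemma adj_eqI:
  fixes S T :: "'h::complex_hilbert_space operator"
  assumes "T \<in> bounded_ops" and S: "\<And>x y. inner (T x) y = inner x (S y)"
  shows "adj T = S" and "S \<in> bounded_ops"
proof -
  have eq: "a = b" if "\<And>x. inner x a = inner x b" for a b :: 'h
    using that vector_eq_ldot by blast
  show bS: "S \<in> bounded_ops"
  proof (rule bounded_opsI, rule eq)
    fix x y :: 'h
    have "inner y (S (\<i> *\<^sub>C x)) = - inner (T (\<i> *\<^sub>C y)) x"
      using assms(1) by (simp add: S[symmetric] bounded_opsD inner_ii_left)
    also have "\<dots> = inner y (\<i> *\<^sub>C S x)"
      by (simp add: S inner_ii_left)
    finally show "inner y (S (\<i> *\<^sub>C x)) = inner y (\<i> *\<^sub>C S x)" .
  qed
  show "adj T = S"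
    unfolding adj_def
  proof (rule the_equality)
    show "\<forall>\<xi> \<eta>. cinner (T \<xi>) \<eta> = cinner \<xi> (S \<eta>)"
    proof (intro allI complex_eqI)
      fix \<xi> \<eta>
      show "Re (cinner (T \<xi>) \<eta>) = Re (cinner \<xi> (S \<eta>))" by (simp add: Re_cinner S)
      show "Im (cinner (T \<xi>) \<eta>) = Im (cinner \<xi> (S \<eta>))"
        using bS by (simp add: Im_cinner S bounded_opsD)
    qed
    fix S' :: "'h operator" assume "\<forall>\<xi> \<eta>. cinner (T \<xi>) \<eta> = cinner \<xi> (S' \<eta>)"
    then have "inner (T x) y = inner x (S' y)" for x y by (simp flip: Re_cinner)
    then show "S' = S" by (intro blinfun_eqI eq) (simp flip: S)
  qed
qed

lemma inner_adj:
  fixes T :: "'h::complex_hilbert_space operator"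
  assumes "T \<in> bounded_ops"
  shows "inner (T x) y = inner x (adj T y)"
  using real_adjoint_exists[of T] adj_eqI(1)[OF assms] by metis

section \<open>Positive operators\<close>

text \<open>Symmetry for the real inner product only; on \<open>bounded_ops\<close> it amounts to
  \<open>adj T = T\<close>. Arguments about positivity thus stay real.\<close>

definition selfadj :: "('a::real_inner \<Rightarrow>\<^sub>L 'a) \<Rightarrow> bool" where
  "selfadj T \<longleftrightarrow> (\<forall>x y. inner (T x) y = inner x (T y))"

definition pos :: "('a::real_inner \<Rightarrow>\<^sub>L 'a) \<Rightarrow> bool" where
  "pos T \<longleftrightarrow> selfadj T \<and> (\<forall>x. 0 \<le> inner x (T x))"

lemma selfadjD: "selfadj T \<Longrightarrow> inner (T x) y = inner x (T y)"
  by (simp add: selfadj_def)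

lemma selfadj_add: "selfadj S \<Longrightarrow> selfadj T \<Longrightarrow> selfadj (S + T)"
  and selfadj_diff: "selfadj S \<Longrightarrow> selfadj T \<Longrightarrow> selfadj (S - T)"
  and selfadj_scaleR: "selfadj T \<Longrightarrow> selfadj (r *\<^sub>R T)"
  and selfadj_id: "selfadj id_blinfun"
  by (simp_all add: selfadj_def blinfun.bilinear_simps inner_simps)

lemma selfadj_compose:
  "selfadj S \<Longrightarrow> selfadj T \<Longrightarrow> S o\<^sub>L T = T o\<^sub>L S \<Longrightarrow> selfadj (S o\<^sub>L T)"
  unfolding selfadj_def by (metis blinfun_apply_blinfun_compose)

lemma pos_add: "pos S \<Longrightarrow> pos T \<Longrightarrow> pos (S + T)"
  by (simp add: pos_def selfadj_add blinfun.bilinear_simps inner_simps)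

lemma pos_scaleR: "pos T \<Longrightarrow> 0 \<le> r \<Longrightarrow> pos (r *\<^sub>R T)"
  by (simp add: pos_def selfadj_scaleR blinfun.bilinear_simps)

lemma pos_square: "selfadj T \<Longrightarrow> pos (T o\<^sub>L T)"
  unfolding pos_def by (metis selfadj_compose selfadjD blinfun_apply_blinfun_compose inner_ge_zero)

lemma inner_le_norm_op: "\<bar>inner x (T x)\<bar> \<le> norm T * (norm x)\<^sup>2"
  for T :: "'a::real_inner \<Rightarrow>\<^sub>L 'a"
proof -
  have "\<bar>inner x (T x)\<bar> \<le> norm x * norm (T x)" by (rule Cauchy_Schwarz_ineq2)
  also have "\<dots> \<le> norm x * (norm T * norm x)" by (intro mult_left_mono norm_blinfun) simp
  finally show ?thesis by (simp add: power2_eq_square mult_ac)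
qed

lemma pos_norm_diff:
  assumes "selfadj T" "norm T \<le> c"
  shows "pos (c *\<^sub>R id_blinfun - T)"
proof -
  have "inner x (T x) \<le> c * inner x x" for x
    using inner_le_norm_op[of x T] mult_right_mono[OF assms(2), of "(norm x)\<^sup>2"]
    by (simp add: power2_norm_eq_inner)
  then show ?thesis
    using assms(1) by (simp add: pos_def selfadj_diff selfadj_scaleR selfadj_id
        blinfun.bilinear_simps inner_simps)
qed

lemma pos_limit:
  assumes "\<And>n::nat. pos (S + inverse (real (Suc n)) *\<^sub>R R)" and "selfadj S"
  shows "pos S"
  unfolding pos_def
proof (intro conjI allI)
  fix x
  have "(\<lambda>n. inner x (S x) + inverse (real (Suc n)) * inner x (R x))
      \<longlonglongrightarrow> inner x (S x) + 0 * inner x (R x)"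
    by (intro tendsto_intros LIMSEQ_inverse_real_of_nat)
  moreover have "0 \<le> inner x (S x) + inverse (real (Suc n)) * inner x (R x)" for n
    using assms(1)[of n] by (simp add: pos_def blinfun.bilinear_simps inner_simps)
  ultimately show "0 \<le> inner x (S x)"
    by (intro LIMSEQ_le_const[where a = 0]) auto
qed (rule assms)

text \<open>For \<open>T \<noteq> 0\<close> this comes from evaluating the form of \<open>T\<close> at \<open>x - T x / \<parallel>T\<parallel>\<close>.\<close>

lemma pos_norm_apply:
  assumes "pos T"
  shows "(norm (T x))\<^sup>2 \<le> norm T * inner x (T x)"
proof (cases "norm T = 0")
  case False
  define t where "t = 1 / norm T"
  have sa: "inner (T x) y = inner x (T y)" for x y
    using assms by (simp add: pos_def selfadj_def)
  have "0 \<le> inner (x - t *\<^sub>R T x) (T (x - t *\<^sub>R T x))"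
    using assms by (simp add: pos_def)
  also have "\<dots> = inner x (T x) - 2 * t * (norm (T x))\<^sup>2 + t\<^sup>2 * inner (T x) (T (T x))"
    by (simp add: blinfun.bilinear_simps inner_simps dot_square_norm sa[of x, symmetric] power2_eq_square
        algebra_simps)
  also have "\<dots> \<le> inner x (T x) - 2 * t * (norm (T x))\<^sup>2 + t\<^sup>2 * (norm T * (norm (T x))\<^sup>2)"
    using inner_le_norm_op[of "T x" T] by (intro add_left_mono mult_left_mono) auto
  also have "\<dots> = inner x (T x) - t * (norm (T x))\<^sup>2"
    using False by (simp add: t_def power2_eq_square)
  finally show ?thesis
    using False by (simp add: t_def field_simps)
qed simp

text \<open>In the expanded square, \<open>pos_norm_apply\<close> lets the cross term absorb
  \<open>(norm (T x))\<^sup>2\<close>. With \<open>pos_norm_diff\<close> this expresses positivity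
  by norms, which a contraction respects.\<close>

lemma norm_diff_pos:
  assumes "pos T"
  shows "norm (norm T *\<^sub>R id_blinfun - T) \<le> norm T"
proof (rule norm_blinfun_bound)
  fix x
  have "(norm ((norm T *\<^sub>R id_blinfun - T) x))\<^sup>2
      = (norm T * norm x)\<^sup>2 - 2 * norm T * inner x (T x) + (norm (T x))\<^sup>2"
    unfolding power_mult_distrib power2_norm_eq_inner
    by (simp add: blinfun.bilinear_simps inner_simps inner_commute power2_eq_square algebra_simps)
  also have "\<dots> \<le> (norm T * norm x)\<^sup>2"
    using pos_norm_apply[OF assms, of x] zero_le_power2[of "norm (T x)"] by linarith
  finally show "norm ((norm T *\<^sub>R id_blinfun - T) x) \<le> norm T * norm x"
    by (rule power2_le_imp_le) simp
qed simp

section \<open>Square roots and products of positive operators in closed algebras\<close>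

definition closed_unital_algebra :: "('a::real_normed_vector \<Rightarrow>\<^sub>L 'a) set \<Rightarrow> bool" where
  "closed_unital_algebra A \<longleftrightarrow> closed A \<and> id_blinfun \<in> A \<and>
     (\<forall>x\<in>A. \<forall>y\<in>A. x + y \<in> A \<and> x o\<^sub>L y \<in> A) \<and> (\<forall>r. \<forall>x\<in>A. r *\<^sub>R x \<in> A)"

lemma closed_selfadj: "closed {T :: 'a::real_inner \<Rightarrow>\<^sub>L 'a. selfadj T}"
  unfolding selfadj_def
  by (intro closed_Collect_all closed_Collect_eq continuous_intros)

lemma closed_unital_algebraD:
  assumes "closed_unital_algebra A"
  shows "closed A" "id_blinfun \<in> A" "\<And>x y. x \<in> A \<Longrightarrow> y \<in> A \<Longrightarrow> x + y \<in> A"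
    "\<And>x y. x \<in> A \<Longrightarrow> y \<in> A \<Longrightarrow> x o\<^sub>L y \<in> A" "\<And>r x. x \<in> A \<Longrightarrow> r *\<^sub>R x \<in> A"
    "\<And>x y. x \<in> A \<Longrightarrow> y \<in> A \<Longrightarrow> x - y \<in> A"
proof -
  show "x - y \<in> A" if "x \<in> A" "y \<in> A" for x y
    using assms that unfolding closed_unital_algebra_def
    by (metis diff_conv_add_uminus scaleR_minus1_left)
qed (use assms in \<open>auto simp: closed_unital_algebra_def\<close>)

interpretation compose: bounded_bilinear
  "(o\<^sub>L) :: ('b::real_normed_vector \<Rightarrow>\<^sub>L 'c::real_normed_vector)
    \<Rightarrow> ('a::real_normed_vector \<Rightarrow>\<^sub>L 'b) \<Rightarrow> _"
  by (rule bounded_bilinear_blinfun_compose)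

lemma compose_assoc: "(R o\<^sub>L S) o\<^sub>L T = R o\<^sub>L (S o\<^sub>L T)"
  by (rule blinfun_eqI) simp

lemmas compose_simps = compose.add_left compose.add_right compose.diff_left compose.diff_right
  compose.scaleR_left compose.scaleR_right compose_assoc

lemma compose_id: "T o\<^sub>L id_blinfun = T" "id_blinfun o\<^sub>L T = T"
  by (auto intro!: blinfun_eqI)

text \<open>\<open>1 - s\<close> is a square root of \<open>1 - y\<close> if and only if \<open>s = (y + s\<^sup>2) / 2\<close>, and the right-hand side
  is a contraction on the ball of radius \<open>\<parallel>y\<parallel> < 1\<close>.\<close>

lemma sqrt_one_minus:
  fixes A :: "('a::{real_inner,banach} \<Rightarrow>\<^sub>L 'a) set"
  assumes A: "closed_unital_algebra A" and y: "y \<in> A" "selfadj y" "norm y < 1"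
  shows "\<exists>b\<in>A. selfadj b \<and> b o\<^sub>L b = id_blinfun - y"
proof -
  note AD = closed_unital_algebraD[OF A]
  define q where "q = norm y"
  have q: "0 \<le> q" "q < 1" using y by (auto simp: q_def)
  \<comment> \<open>Iterating inside this set makes the fixed point a self-adjoint element of
    \<open>A\<close>. The ball is preserved because \<open>(q + q * q) / 2\<close> is at most
    \<open>q\<close>.\<close>
  define S where "S = A \<inter> {s. selfadj s} \<inter> cball 0 q"
  define f where "f s = (1/2) *\<^sub>R (y + (s o\<^sub>L s))" for s
  have "\<exists>!s\<in>S. f s = s"
  proof (rule Banach_fix)
    show "complete S"
      unfolding S_def by (intro closed_Int AD closed_selfadj closed_cball complete_eq_closed[THEN iffD2])
    show "S \<noteq> {}"
      using y by (auto simp: S_def q_def)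
    show "0 \<le> q" "q < 1" by (fact q)+
    show "f ` S \<subseteq> S"
    proof
      fix z assume "z \<in> f ` S"
      then obtain s where s: "s \<in> A" "selfadj s" "norm s \<le> q" "z = f s" by (auto simp: S_def)
      have "norm (s o\<^sub>L s) \<le> q * q"
        using norm_blinfun_compose[of s s] s q by (meson mult_mono norm_ge_zero order_trans)
      also have "\<dots> \<le> q" using q by (simp add: mult_left_le)
      finally have "norm (y + (s o\<^sub>L s)) \<le> 2 * q"
        using norm_triangle_ineq[of y "s o\<^sub>L s"] by (simp add: q_def)
      then show "z \<in> S"
        using s y by (auto simp: S_def f_def intro!: AD selfadj_scaleR selfadj_add selfadj_compose)
    qed
    show "dist (f s) (f t) \<le> q * dist s t" if "s \<in> S" "t \<in> S" for s t
    proof -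
      have st: "norm s \<le> q" "norm t \<le> q" using that by (auto simp: S_def)
      have "f s - f t = (1/2) *\<^sub>R ((s o\<^sub>L (s - t)) + ((s - t) o\<^sub>L t))"
        by (simp add: f_def compose_simps algebra_simps)
      also have "norm \<dots> \<le> (1/2) * (norm s * norm (s - t) + norm (s - t) * norm t)"
        using norm_triangle_ineq[of "s o\<^sub>L (s - t)" "(s - t) o\<^sub>L t"]
          norm_blinfun_compose[of s "s - t"] norm_blinfun_compose[of "s - t" t] by simp
      also have "\<dots> \<le> (1/2) * (q * norm (s - t) + norm (s - t) * q)"
        using st by (intro mult_left_mono add_mono mult_mono) (auto intro: q)
      finally show "dist (f s) (f t) \<le> q * dist s t" by (simp add: dist_norm mult_ac)
    qed
  qed
  then obtain s where s: "s \<in> A" "selfadj s" "f s = s" by (auto simp: S_def)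
  have "(id_blinfun - s) o\<^sub>L (id_blinfun - s) = id_blinfun - (2 *\<^sub>R s - (s o\<^sub>L s))"
    by (simp add: compose_simps compose_id scaleR_2)
  also have "2 *\<^sub>R s = 2 *\<^sub>R f s" by (simp add: s)
  also have "\<dots> = y + (s o\<^sub>L s)" by (simp add: f_def)
  finally show ?thesis
    using s by (intro bexI[of _ "id_blinfun - s"]) (auto intro!: AD selfadj_diff selfadj_id)
qed

text \<open>Rescaling by \<open>c = norm P + e\<close> turns \<open>P + e\<close> into
  \<open>1 - y\<close> with \<open>norm y\<close> at most \<open>norm P / c\<close>; the shift by
  \<open>e\<close> makes this bound strictly less than 1.\<close>

lemma sqrt_exists:
  fixes A :: "('a::{real_inner,banach} \<Rightarrow>\<^sub>L 'a) set"
  assumes A: "closed_unital_algebra A" and P: "P \<in> A" "pos P" and e: "0 < e"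
  shows "\<exists>b\<in>A. selfadj b \<and> b o\<^sub>L b = P + e *\<^sub>R id_blinfun"
proof -
  note AD = closed_unital_algebraD[OF A]
  define c where "c = norm P + e"
  have c: "0 < c" "norm P < c" using e by (auto simp: c_def add_nonneg_pos)
  define y where "y = (1 / c) *\<^sub>R (norm P *\<^sub>R id_blinfun - P)"
  have "norm y \<le> (1 / c) * norm P"
    using norm_diff_pos[OF P(2)] c by (simp add: y_def divide_right_mono)
  also have "\<dots> < 1" using c by (simp add: divide_simps)
  finally have "norm y < 1" .
  moreover have "y \<in> A" "selfadj y"
    using P by (auto simp: y_def pos_def intro!: AD selfadj_scaleR selfadj_diff selfadj_id)
  ultimately obtain b where b: "b \<in> A" "selfadj b" "b o\<^sub>L b = id_blinfun - y"
    using sqrt_one_minus[OF A] by blast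
  have "(sqrt c *\<^sub>R b) o\<^sub>L (sqrt c *\<^sub>R b) = c *\<^sub>R (b o\<^sub>L b)"
    using c by (simp add: compose_simps)
  also have "\<dots> = c *\<^sub>R id_blinfun - (norm P *\<^sub>R id_blinfun - P)"
    using c by (simp add: b y_def scaleR_diff_right)
  also have "\<dots> = P + e *\<^sub>R id_blinfun" by (simp add: c_def algebra_simps)
  finally show ?thesis
    using b by (intro bexI[of _ "sqrt c *\<^sub>R b"]) (auto intro: AD selfadj_scaleR)
qed

text \<open>If \<open>b\<close> is a square root of \<open>Q + e\<close> in the commutative algebra,
  then \<open>P (Q + e) = b P b\<close> is positive; let \<open>e\<close> tend to 0.\<close>

lemma pos_compose:
  fixes A :: "('a::{real_inner,banach} \<Rightarrow>\<^sub>L 'a) set"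
  assumes A: "closed_unital_algebra A"
    and comm: "\<And>x y. x \<in> A \<Longrightarrow> y \<in> A \<Longrightarrow> x o\<^sub>L y = y o\<^sub>L x"
    and P: "P \<in> A" "pos P" and Q: "Q \<in> A" "pos Q"
  shows "pos (P o\<^sub>L Q)"
proof -
  have PQ: "selfadj (P o\<^sub>L Q)"
    using P Q comm by (intro selfadj_compose) (auto simp: pos_def)
  have "pos ((P o\<^sub>L Q) + e *\<^sub>R P)" if e: "0 < e" for e
  proof -
    obtain b where b: "b \<in> A" "selfadj b" "b o\<^sub>L b = Q + e *\<^sub>R id_blinfun"
      using sqrt_exists[OF A Q e] by blast
    have "(P o\<^sub>L Q) + e *\<^sub>R P = P o\<^sub>L (b o\<^sub>L b)"
      by (simp add: b compose_simps compose_id)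
    also have "\<dots> = b o\<^sub>L (P o\<^sub>L b)"
      by (metis comm[OF P(1) b(1)] compose_assoc)
    finally have "inner x (((P o\<^sub>L Q) + e *\<^sub>R P) x) = inner (b x) (P (b x))" for x
      by (simp flip: selfadjD[OF b(2)])
    then show ?thesis
      using P PQ unfolding pos_def by (auto intro!: selfadj_add selfadj_scaleR)
  qed
  then have "pos ((P o\<^sub>L Q) + inverse (real (Suc n)) *\<^sub>R P)" for n by simp
  then show ?thesis using PQ by (rule pos_limit)
qed

text \<open>The operator \<open>h\<close> itself is not an admissible scalar \<open>r\<close>.
  Averaging the shifts over a walk whose step probability is the operator \<open>h\<close> centres
  them at \<open>h\<close>, at the cost of a variance that can be made arbitrarily small.\<close>

lemma pos_of_pos_square_shifts:
  fixes A :: "('a::{real_inner,banach} \<Rightarrow>\<^sub>L 'a) set"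
  assumes A: "closed_unital_algebra A"
    and comm: "\<And>x y. x \<in> A \<Longrightarrow> y \<in> A \<Longrightarrow> x o\<^sub>L y = y o\<^sub>L x"
    and d: "d \<in> A" "selfadj d" and h: "h \<in> A" "pos h" "pos (id_blinfun - h)"
    and shifts: "\<And>r. pos (d + ((h - r *\<^sub>R id_blinfun) o\<^sub>L (h - r *\<^sub>R id_blinfun)))"
  shows "pos d"
proof -
  note AD = closed_unital_algebraD[OF A]
  \<comment> \<open>\<open>G \<tau> n s = d + (h - s\<tau> - n\<tau>h)\<^sup>2 + n\<tau>\<^sup>2h(1 - h)\<close> is the mean of \<open>d + (h - \<tau>X)\<^sup>2\<close> for \<open>X\<close> the
    position, after \<open>n\<close> steps from \<open>s\<close>, of a walk that goes up by 1 with probability \<open>h\<close>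
    and stays put with probability \<open>1 - h\<close>.\<close>
  define G where "G \<tau> n s = d + (s * \<tau>)\<^sup>2 *\<^sub>R id_blinfun
      + (real n * \<tau>\<^sup>2 - 2 * s * \<tau> * (1 - real n * \<tau>)) *\<^sub>R h
      + ((1 - real n * \<tau>)\<^sup>2 - real n * \<tau>\<^sup>2) *\<^sub>R (h o\<^sub>L h)" for \<tau> n s
  have GA: "G \<tau> n s \<in> A" for \<tau> n s
    unfolding G_def by (intro AD d h)
  have G: "pos (G \<tau> n s)" for \<tau> n s
  proof (induction n arbitrary: s)
    case 0
    have "G \<tau> 0 s = d + ((h - (s * \<tau>) *\<^sub>R id_blinfun) o\<^sub>L (h - (s * \<tau>) *\<^sub>R id_blinfun))"
      by (rule blinfun_eqI)
        (simp add: G_def blinfun.bilinear_simps power2_eq_square algebra_simps flip: scaleR_2)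
    then show ?case using shifts by simp
  next
    case (Suc n)
    have step: "G \<tau> n (s + 1) - G \<tau> n s
        = ((2 * s + 1) * \<tau>\<^sup>2) *\<^sub>R id_blinfun - (2 * \<tau> * (1 - real n * \<tau>)) *\<^sub>R h"
      by (rule blinfun_eqI)
        (simp add: G_def blinfun.bilinear_simps power2_eq_square algebra_simps,
          simp flip: scaleR_add_left)
    \<comment> \<open>Condition on the first step: weight \<open>h\<close> for moving to
      \<open>s + 1\<close>, weight \<open>1 - h\<close> for staying. Both weights are positive and
      commute with \<open>G\<close>.\<close>
    have "pos ((h o\<^sub>L G \<tau> n (s + 1)) + ((id_blinfun - h) o\<^sub>L G \<tau> n s))"
      by (intro pos_add pos_compose[OF A comm] h GA Suc AD)
    also have "(h o\<^sub>L G \<tau> n (s + 1)) + ((id_blinfun - h) o\<^sub>L G \<tau> n s)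
        = G \<tau> n s + (h o\<^sub>L (G \<tau> n (s + 1) - G \<tau> n s))"
      by (simp add: compose_simps compose_id)
    also have "\<dots> = G \<tau> (Suc n) s"
      unfolding step
      by (rule blinfun_eqI)
        (simp add: G_def blinfun.bilinear_simps power2_eq_square algebra_simps,
          simp flip: scaleR_add_left)
    finally show ?case .
  qed
  show ?thesis
  proof (rule pos_limit[OF _ d(2)])
    fix n
    \<comment> \<open>With step length \<open>1 / (n + 1)\<close> and \<open>n + 1\<close> steps
      from 0 the mean is exactly \<open>h\<close>, and only the variance term survives.\<close>
    have "real (Suc n) * inverse (real (Suc n)) = 1" by simp
    then have "G (inverse (real (Suc n))) (Suc n) 0
        = d + inverse (real (Suc n)) *\<^sub>R (h - (h o\<^sub>L h))"
      unfolding G_def by (simp only: power2_eq_square mult.assoc[symmetric])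
        (simp add: scaleR_diff_right)
    then show "pos (d + inverse (real (Suc n)) *\<^sub>R (h - (h o\<^sub>L h)))"
      using G by metis
  qed
qed

section \<open>Conditional expectations\<close>

lemma scaleC_op_of_real: "scaleC_op (complex_of_real r) T = r *\<^sub>R T"
  by (rule blinfun_eqI) (simp add: scaleC_op.rep_eq scaleC_of_real blinfun.bilinear_simps)

lemma closed_bounded_ops: "closed (bounded_ops :: 'h::complex_hilbert_space operator set)"
proof -
  \<comment> \<open>Writing multiplication by \<open>\<i>\<close> as a bounded operator makes both
    sides visibly continuous in \<open>T\<close>.\<close>
  have "bounded_ops = {T :: 'h operator. \<forall>x. T (\<i> *\<^sub>C x) = scaleC_op \<i> id_blinfun (T x)}"
    by (auto simp: scaleC_op.rep_eq bounded_opsD intro!: bounded_opsI)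
  also have "closed \<dots>"
    by (intro closed_Collect_all closed_Collect_eq continuous_intros)
  finally show ?thesis .
qed

text \<open>Covers every von Neumann algebra, since each is the commutant of its commutant.\<close>

lemma closed_unital_algebra_commutant: "closed_unital_algebra (commutant A)"
  unfolding closed_unital_algebra_def
proof (intro conjI ballI allI)
  have "commutant A = bounded_ops \<inter> (\<Inter>a\<in>A. {T. T o\<^sub>L a = a o\<^sub>L T})"
    by (auto simp: commutant_def)
  also have "closed \<dots>"
    by (intro closed_Int closed_bounded_ops closed_INT ballI closed_Collect_eq continuous_intros)
  finally show "closed (commutant A)" .
  show "id_blinfun \<in> commutant A"
    by (simp add: commutant_def bounded_ops_def compose_id)
  fix x assume x: "x \<in> commutant A"
  show "r *\<^sub>R x \<in> commutant A" for r
    using x by (auto simp: commutant_def compose_simps blinfun.bilinear_simps bounded_opsD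
        scaleC_real_commute intro!: bounded_opsI)
  fix y assume y: "y \<in> commutant A"
  show "x + y \<in> commutant A"
    using x y by (auto simp: commutant_def compose_simps blinfun.bilinear_simps bounded_opsD
        scaleC_add_right intro!: bounded_opsI)
  have "x o\<^sub>L (y o\<^sub>L a) = a o\<^sub>L (x o\<^sub>L y)" if "a \<in> A" for a
    using x y that unfolding commutant_def by (metis (mono_tags, lifting) compose_assoc mem_Collect_eq)
  then show "x o\<^sub>L y \<in> commutant A"
    using x y by (auto simp: commutant_def compose_assoc bounded_opsD intro!: bounded_opsI)
qed

lemma von_neumann_algebra_closed_unital_algebra:
  "von_neumann_algebra M \<Longrightarrow> closed_unital_algebra M"
  by (metis von_neumann_algebra_def closed_unital_algebra_commutant)

lemma von_neumann_algebra_scaleC: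
  assumes M: "von_neumann_algebra M" and x: "x \<in> M"
  shows "scaleC_op c x \<in> M"
proof -
  have x': "x \<in> bounded_ops" "\<And>a. a \<in> commutant M \<Longrightarrow> x o\<^sub>L a = a o\<^sub>L x"
    using assms by (auto simp: von_neumann_algebra_def commutant_def)
  have "scaleC_op c x o\<^sub>L a = a o\<^sub>L scaleC_op c x" if a: "a \<in> commutant M" for a
  proof (rule blinfun_eqI)
    fix u
    have "x (a u) = a (x u)"
      using x'(2)[OF a] by (metis blinfun_apply_blinfun_compose)
    then show "(scaleC_op c x o\<^sub>L a) u = (a o\<^sub>L scaleC_op c x) u"
      using a by (simp add: scaleC_op.rep_eq bounded_opsD commutant_def)
  qed
  moreover have "scaleC_op c x \<in> bounded_ops"
    using x'(1) by (auto simp: scaleC_op.rep_eq bounded_opsD scaleC_scaleC mult.commute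
        intro!: bounded_opsI)
  ultimately have "scaleC_op c x \<in> commutant (commutant M)"
    by (simp add: commutant_def)
  then show ?thesis using M by (simp add: von_neumann_algebra_def)
qed

lemma adj_selfadj:
  assumes "T \<in> bounded_ops" "selfadj T"
  shows "adj T = T"
  using adj_eqI(1)[OF assms(1)] selfadjD[OF assms(2)] by blast

text \<open>The expression is the imaginary part of \<open>cinner x (T x)\<close>. Polarization,
  followed by replacing \<open>y\<close> by \<open>\<i> *\<^sub>C y\<close>, recovers symmetry from
  a real quadratic form.\<close>

lemma selfadj_iff_inner_ii:
  assumes T: "T \<in> bounded_ops"
  shows "selfadj T \<longleftrightarrow> (\<forall>x. inner (\<i> *\<^sub>C x) (T x) = 0)"
proof
  assume T': "selfadj T"
  have "inner (\<i> *\<^sub>C x) (T x) = - inner (\<i> *\<^sub>C x) (T x)" for x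
    using selfadjD[OF T', of x "\<i> *\<^sub>C x"] T inner_ii_left[of x "T x"]
    by (simp add: bounded_opsD inner_commute)
  then show "\<forall>x. inner (\<i> *\<^sub>C x) (T x) = 0" by simp
next
  assume *: "\<forall>x. inner (\<i> *\<^sub>C x) (T x) = 0"
  have pol: "inner (\<i> *\<^sub>C x) (T y) + inner (\<i> *\<^sub>C y) (T x) = 0" for x y
    using *[rule_format, of "x + y"] *
    by (simp add: scaleC_add_right blinfun.bilinear_simps inner_simps)
  have "inner x (T y) = inner y (T x)" for x y
    using pol[of x "\<i> *\<^sub>C y"] T
    by (simp add: bounded_opsD inner_ii_left scaleC_ii_ii)
  then show "selfadj T" by (simp add: selfadj_def inner_commute)
qed

text \<open>By complex linearity of expectations, this reduces the tower property to self-adjoint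
  elements.\<close>

lemma selfadj_decomposition:
  assumes M: "von_neumann_algebra M" and x: "x \<in> M"
  shows "\<exists>a\<in>M. \<exists>b\<in>M. selfadj a \<and> selfadj b \<and> x = a + scaleC_op \<i> b"
proof -
  note AD = closed_unital_algebraD[OF von_neumann_algebra_closed_unital_algebra[OF M]]
  have B: "M \<subseteq> bounded_ops" and xs: "adj x \<in> M"
    using M x by (auto simp: von_neumann_algebra_def)
  have adj: "inner (x u) v = inner u (adj x v)" "inner u (x v) = inner (adj x u) v" for u v
    using inner_adj[of x] x B by (metis subsetD inner_commute)+
  define a where "a = (1/2) *\<^sub>R (x + adj x)"
  define b where "b = scaleC_op (- \<i>) ((1/2) *\<^sub>R (x - adj x))"
  have "a \<in> M" "b \<in> M"
    unfolding a_def b_def using x xs by (auto intro!: AD von_neumann_algebra_scaleC[OF M])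
  moreover have "selfadj a"
    by (simp add: selfadj_def a_def blinfun.bilinear_simps inner_simps adj)
  moreover have "selfadj b"
  proof -
    have "inner (\<i> *\<^sub>C u) (b u) = 0" for u
      using adj[of u u]
      by (simp add: b_def scaleC_op.rep_eq blinfun.bilinear_simps inner_simps inner_ii_left
          scaleC_scaleC inner_commute scaleC_of_real[of 1, simplified])
    then show ?thesis using \<open>b \<in> M\<close> B by (subst selfadj_iff_inner_ii) auto
  qed
  moreover have "x = a + scaleC_op \<i> b"
  proof (rule blinfun_eqI)
    fix u
    have "scaleC_op \<i> b u = (1/2) *\<^sub>R (x u - adj x u)"
      by (simp add: b_def scaleC_op.rep_eq blinfun.bilinear_simps scaleC_scaleC
          scaleC_of_real[of 1, simplified])
    moreover have "x u = (1/2) *\<^sub>R (x u + adj x u) + (1/2) *\<^sub>R (x u - adj x u)"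
      by (simp add: scaleR_add_right[symmetric] flip: scaleR_2)
    ultimately show "x u = (a + scaleC_op \<i> b) u"
      by (simp add: a_def blinfun.bilinear_simps)
  qed
  ultimately show ?thesis by blast
qed

section \<open>Positivity and Kadison's inequality for an expectation\<close>

locale expectation =
  fixes M N :: "'h::complex_hilbert_space operator set" and E :: "'h operator \<Rightarrow> 'h operator"
  assumes M: "von_neumann_algebra M" and N: "von_neumann_subalgebra N M" and abel: "abelian N"
    and E: "conditional_expectation M N E"
begin

lemma N_vN: "von_neumann_algebra N" and N_sub: "N \<subseteq> M"
  using N by (auto simp: von_neumann_subalgebra_def)

lemma M_bounded: "x \<in> M \<Longrightarrow> x \<in> bounded_ops"
  using M by (auto simp: von_neumann_algebra_def)

lemmas MA = closed_unital_algebraD[OF von_neumann_algebra_closed_unital_algebra[OF M]]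
lemmas NA = closed_unital_algebraD[OF von_neumann_algebra_closed_unital_algebra[OF N_vN]]

lemma E_in: "x \<in> M \<Longrightarrow> E x \<in> N" and E_fix: "x \<in> N \<Longrightarrow> E x = x"
  and E_norm: "x \<in> M \<Longrightarrow> norm (E x) \<le> norm x"
  and E_add: "x \<in> M \<Longrightarrow> y \<in> M \<Longrightarrow> E (x + y) = E x + E y"
  and E_scaleC: "x \<in> M \<Longrightarrow> E (scaleC_op c x) = scaleC_op c (E x)"
  using E by (auto simp: conditional_expectation_def clinear_on_def)

lemma E_scaleR: "x \<in> M \<Longrightarrow> E (r *\<^sub>R x) = r *\<^sub>R E x"
  using E_scaleC[of x "complex_of_real r"] by (simp add: scaleC_op_of_real)

lemma E_diff: "x \<in> M \<Longrightarrow> y \<in> M \<Longrightarrow> E (x - y) = E x - E y"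
  using E_add[of "x - y" y] MA by simp

lemma E_id: "E id_blinfun = id_blinfun"
  by (rule E_fix) (rule NA)

text \<open>Compare the norms of \<open>x + it\<close> and \<open>E x + it\<close> for large real \<open>t\<close> of either sign.\<close>

lemma E_selfadj:
  assumes x: "x \<in> M" "selfadj x"
  shows "selfadj (E x)"
proof -
  have b: "inner (\<i> *\<^sub>C u) (E x u) = 0" for u
  proof -
    define \<beta> where "\<beta> = inner (\<i> *\<^sub>C u) (E x u)"
    define w where "w = norm u"
    have nu: "norm (\<i> *\<^sub>C v) = norm v" for v :: 'h by (simp add: norm_scaleC)
    \<comment> \<open>Squaring the bound on \<open>\<beta> + t * w\<^sup>2\<close> cancels the terms
      in \<open>t\<^sup>2\<close>. The remaining inequality is affine in \<open>t\<close>, so its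
      slope vanishes.\<close>
    have "- 2 * \<beta> * w\<^sup>2 = 0"
    proof (rule linear_term_zero)
      fix t :: real
      define z :: "'h operator" where "z = scaleC_op (\<i> * complex_of_real t) id_blinfun"
      have z: "z \<in> M" "E (x + z) = E x + z"
        unfolding z_def using x
        by (auto simp: E_add E_scaleC E_id MA von_neumann_algebra_scaleC[OF M])
      have zv: "z v = t *\<^sub>R (\<i> *\<^sub>C v)" for v
        by (simp add: z_def scaleC_op.rep_eq scaleC_scaleC[symmetric] scaleC_of_real scaleC_real_commute)
      have "norm (x + z) \<le> sqrt ((norm x)\<^sup>2 + t\<^sup>2)"
      proof (rule norm_blinfun_bound)
        fix v
        \<comment> \<open>Orthogonality of \<open>x v\<close> and \<open>z v\<close> removes the
          cross term.\<close>
        have "inner (\<i> *\<^sub>C v) (x v) = 0"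
          using x M_bounded selfadj_iff_inner_ii by blast
        then have "(norm ((x + z) v))\<^sup>2 = (norm (x v))\<^sup>2 + t\<^sup>2 * (norm (\<i> *\<^sub>C v))\<^sup>2"
          unfolding power2_norm_eq_inner
          by (simp add: zv blinfun.bilinear_simps inner_simps inner_commute power2_eq_square algebra_simps)
        also have "\<dots> \<le> (norm x * norm v)\<^sup>2 + t\<^sup>2 * (norm v)\<^sup>2"
          unfolding nu by (intro add_mono power_mono norm_blinfun) auto
        also have "\<dots> = (sqrt ((norm x)\<^sup>2 + t\<^sup>2) * norm v)\<^sup>2"
          by (simp add: power_mult_distrib algebra_simps)
        finally show "norm ((x + z) v) \<le> sqrt ((norm x)\<^sup>2 + t\<^sup>2) * norm v"
          by (rule power2_le_imp_le) simp
      qed simp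
      then have nz: "norm (E x + z) \<le> sqrt ((norm x)\<^sup>2 + t\<^sup>2)"
        using E_norm[of "x + z"] z x by (simp add: MA)
      have "\<beta> + t * w\<^sup>2 = inner (\<i> *\<^sub>C u) ((E x + z) u)"
        using nu[of u] by (simp add: zv \<beta>_def w_def blinfun.bilinear_simps inner_simps dot_square_norm)
      also have "\<bar>\<dots>\<bar> \<le> norm (\<i> *\<^sub>C u) * norm ((E x + z) u)"
        by (rule Cauchy_Schwarz_ineq2)
      also have "\<dots> \<le> w * (norm (E x + z) * w)"
        unfolding nu w_def by (intro mult_left_mono norm_blinfun) simp
      also have "\<dots> \<le> w * (sqrt ((norm x)\<^sup>2 + t\<^sup>2) * w)"
        using nz by (intro mult_left_mono mult_right_mono) (auto simp: w_def)
      finally have "(\<beta> + t * w\<^sup>2)\<^sup>2 \<le> (w * (sqrt ((norm x)\<^sup>2 + t\<^sup>2) * w))\<^sup>2"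
        by (metis abs_le_square_iff abs_of_nonneg abs_ge_zero order_trans)
      then show "0 \<le> t * (- 2 * \<beta> * w\<^sup>2) + ((norm x)\<^sup>2 * w ^ 4 - \<beta>\<^sup>2)"
        by (simp add: power_mult_distrib power2_sum) (simp add: algebra_simps power2_eq_square power4_eq_xxxx)
    qed
    then show ?thesis by (cases "u = 0") (auto simp: \<beta>_def w_def)
  qed
  show ?thesis
    using b E_in[OF x(1)] N_sub M_bounded by (subst selfadj_iff_inner_ii) auto
qed

text \<open>A positive \<open>x\<close> is within \<open>norm x\<close> of \<open>norm x\<close>
  times the identity. The unital contraction \<open>E\<close> preserves this estimate, which forces
  \<open>E x\<close> to be positive.\<close>

lemma E_pos:
  assumes x: "x \<in> M" "pos x"
  shows "pos (E x)"
proof -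
  have sa: "selfadj x" using x by (simp add: pos_def)
  have "norm (E (norm x *\<^sub>R id_blinfun - x)) \<le> norm x"
    using E_norm[of "norm x *\<^sub>R id_blinfun - x"] norm_diff_pos[OF x(2)] x by (simp add: MA)
  moreover have "E (norm x *\<^sub>R id_blinfun - x) = norm x *\<^sub>R id_blinfun - E x"
    using x by (simp add: E_diff E_scaleR E_id MA)
  ultimately have "pos (norm x *\<^sub>R id_blinfun - (norm x *\<^sub>R id_blinfun - E x))"
    using x sa by (intro pos_norm_diff selfadj_diff selfadj_scaleR selfadj_id E_selfadj) auto
  then show ?thesis by simp
qed

text \<open>Applying \<open>E\<close> to \<open>(x - r)\<^sup>2\<close> gives the defect plus
  \<open>(E x - r)\<^sup>2\<close>, so the shift lemma applies in the abelian algebra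
  \<open>N\<close> with \<open>h = E x\<close>.\<close>

lemma kadison_unit:
  assumes x: "x \<in> M" "selfadj x" and h: "pos (E x)" "pos (id_blinfun - E x)"
  shows "pos (E (x o\<^sub>L x) - (E x o\<^sub>L E x))"
proof (rule pos_of_pos_square_shifts[OF von_neumann_algebra_closed_unital_algebra[OF N_vN], where h = "E x"])
  show "a o\<^sub>L b = b o\<^sub>L a" if "a \<in> N" "b \<in> N" for a b
    using abel that by (auto simp: abelian_def)
  show "E (x o\<^sub>L x) - (E x o\<^sub>L E x) \<in> N" "E x \<in> N"
    using x by (auto intro!: NA E_in MA)
  show "selfadj (E (x o\<^sub>L x) - (E x o\<^sub>L E x))"
    using x by (intro selfadj_diff E_selfadj selfadj_compose) (auto intro: MA E_selfadj)
  fix r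
  let ?s = "x - r *\<^sub>R id_blinfun"
  have "pos (E (?s o\<^sub>L ?s))"
    using x by (intro E_pos pos_square selfadj_diff selfadj_scaleR selfadj_id) (auto intro!: MA)
  also have "?s o\<^sub>L ?s = ((x o\<^sub>L x) - (2 * r) *\<^sub>R x) + r\<^sup>2 *\<^sub>R id_blinfun"
    by (rule blinfun_eqI) (simp add: blinfun.bilinear_simps power2_eq_square algebra_simps flip: scaleR_2)
  also have "E \<dots> = (E (x o\<^sub>L x) - (2 * r) *\<^sub>R E x) + r\<^sup>2 *\<^sub>R id_blinfun"
    using x by (simp add: E_add E_diff E_scaleR E_id MA)
  also have "\<dots> = E (x o\<^sub>L x) - (E x o\<^sub>L E x)
      + ((E x - r *\<^sub>R id_blinfun) o\<^sub>L (E x - r *\<^sub>R id_blinfun))"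
    by (rule blinfun_eqI) (simp add: blinfun.bilinear_simps power2_eq_square algebra_simps flip: scaleR_2)
  finally show "pos \<dots>" .
qed (use h in auto)

text \<open>The affine change \<open>z = (x + c) / (2 * c)\<close> puts \<open>E z\<close> between 0
  and 1. The defect ignores the translation and scales by \<open>1 / (4 * c\<^sup>2)\<close>; the
  summand 1 in \<open>c\<close> keeps it nonzero.\<close>

lemma kadison:
  assumes x: "x \<in> M" "selfadj x"
  shows "pos (E (x o\<^sub>L x) - (E x o\<^sub>L E x))"
proof -
  define c where "c = norm (E x) + 1"
  have c: "0 < c" "norm (E x) \<le> c" by (auto simp: c_def add_nonneg_pos)
  define z where "z = (1 / (2 * c)) *\<^sub>R (x + c *\<^sub>R id_blinfun)"
  have z: "z \<in> M" "selfadj z"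
    unfolding z_def using x by (auto intro!: MA selfadj_scaleR selfadj_add selfadj_id)
  have Ez: "E z = (1 / (2 * c)) *\<^sub>R (E x + c *\<^sub>R id_blinfun)"
    unfolding z_def using x by (simp add: E_scaleR E_add E_id MA)
  have "E z = (1 / (2 * c)) *\<^sub>R (c *\<^sub>R id_blinfun - (- E x))"
    unfolding Ez by (simp add: add.commute)
  moreover have "id_blinfun - E z = (1 / (2 * c)) *\<^sub>R (c *\<^sub>R id_blinfun - E x)"
    unfolding Ez using c by (intro blinfun_eqI) (simp add: blinfun.bilinear_simps field_simps flip: scaleR_2)
  moreover have "selfadj (- E x)"
    using selfadj_scaleR[of "E x" "-1"] E_selfadj[OF x] by simp
  ultimately have "pos (E z)" "pos (id_blinfun - E z)"
    using c E_selfadj[OF x] by (simp_all only:) (intro pos_scaleR pos_norm_diff; simp)+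
  then have "pos (E (z o\<^sub>L z) - (E z o\<^sub>L E z))"
    using kadison_unit z by blast
  then have "pos ((4 * c\<^sup>2) *\<^sub>R (E (z o\<^sub>L z) - (E z o\<^sub>L E z)))"
    by (rule pos_scaleR) simp
  also have "(4 * c\<^sup>2) *\<^sub>R (E (z o\<^sub>L z) - (E z o\<^sub>L E z)) = E (x o\<^sub>L x) - (E x o\<^sub>L E x)"
  proof -
    have sq: "(4 * c\<^sup>2) *\<^sub>R (((1 / (2 * c)) *\<^sub>R (y + c *\<^sub>R id_blinfun)) o\<^sub>L ((1 / (2 * c)) *\<^sub>R (y + c *\<^sub>R id_blinfun)))
        = (y o\<^sub>L y) + (2 * c) *\<^sub>R y + c\<^sup>2 *\<^sub>R id_blinfun" for y :: "'h operator"
      using c by (intro blinfun_eqI)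
        (simp add: blinfun.bilinear_simps power2_eq_square algebra_simps flip: scaleR_2)
    have "(4 * c\<^sup>2) *\<^sub>R E (z o\<^sub>L z) = E ((4 * c\<^sup>2) *\<^sub>R (z o\<^sub>L z))"
      using z by (simp add: E_scaleR MA)
    also have "\<dots> = E (x o\<^sub>L x) + (2 * c) *\<^sub>R E x + c\<^sup>2 *\<^sub>R id_blinfun"
      unfolding z_def sq using x by (simp add: E_add E_scaleR E_id MA)
    finally show ?thesis by (simp add: scaleR_diff_right Ez sq)
  qed
  finally show ?thesis .
qed

end

text \<open>The definition of \<open>state\<close> gives positivity on
  \<open>adj b o\<^sub>L b\<close> only, so \<open>P + e\<close> is written as such a square and
  \<open>e\<close> tends to 0.\<close>

lemma state_pos:
  assumes M: "von_neumann_algebra M" and \<psi>: "state M \<psi>" and P: "P \<in> M" "pos P"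
  shows "0 \<le> Re (\<psi> P)"
proof (rule field_le_epsilon)
  fix e :: real assume e: "0 < e"
  note cua = von_neumann_algebra_closed_unital_algebra[OF M]
  note AD = closed_unital_algebraD[OF cua]
  obtain b where b: "b \<in> M" "selfadj b" "b o\<^sub>L b = P + e *\<^sub>R id_blinfun"
    using sqrt_exists[OF cua P e] by blast
  have "adj b = b"
    using b M by (intro adj_selfadj) (auto simp: von_neumann_algebra_def)
  then have "0 \<le> Re (\<psi> (P + e *\<^sub>R id_blinfun))"
    using \<psi> b unfolding state_def by metis
  also have "\<psi> (P + e *\<^sub>R id_blinfun) = \<psi> P + \<psi> (scaleC_op (complex_of_real e) id_blinfun)"
    using \<psi> P AD by (simp add: state_def clinear_on_def scaleC_op_of_real)
  also have "\<dots> = \<psi> P + complex_of_real e"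
    using \<psi> AD by (simp add: state_def clinear_on_def)
  finally show "0 \<le> Re (\<psi> P) + e" by simp
qed

section \<open>The expectation as an orthogonal projection\<close>

locale preserving_expectation = expectation M N E
  for M N :: "'h::complex_hilbert_space operator set" and E +
  fixes \<psi> :: "'h operator \<Rightarrow> complex"
  assumes \<psi>: "state M \<psi>" and preserves: "preserving M \<psi> E"
begin

lemma \<psi>_add: "x \<in> M \<Longrightarrow> y \<in> M \<Longrightarrow> \<psi> (x + y) = \<psi> x + \<psi> y"
  using \<psi> by (auto simp: state_def clinear_on_def)

lemma \<psi>_scaleR: "x \<in> M \<Longrightarrow> \<psi> (r *\<^sub>R x) = complex_of_real r * \<psi> x"
  using \<psi> by (auto simp: state_def clinear_on_def simp flip: scaleC_op_of_real)

text \<open>Kadison's inequality integrated against \<open>\<psi>\<close>, which does not see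
  \<open>E\<close>.\<close>

lemma square_contraction:
  assumes x: "x \<in> M" "selfadj x"
  shows "Re (\<psi> (E x o\<^sub>L E x)) \<le> Re (\<psi> (x o\<^sub>L x))"
proof -
  have Ex: "E x \<in> M" "E (x o\<^sub>L x) \<in> M"
    using x E_in N_sub MA by blast+
  have "0 \<le> Re (\<psi> (E (x o\<^sub>L x) - (E x o\<^sub>L E x)))"
    using x Ex by (intro state_pos[OF M \<psi>] kadison MA)
  moreover have "\<psi> (E (x o\<^sub>L x)) = \<psi> (E (x o\<^sub>L x) - (E x o\<^sub>L E x)) + \<psi> (E x o\<^sub>L E x)"
    using Ex by (subst \<psi>_add[symmetric]) (auto intro!: MA)
  moreover have "\<psi> (E (x o\<^sub>L x)) = \<psi> (x o\<^sub>L x)"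
    using preserves x MA by (simp add: preserving_def)
  ultimately show ?thesis by simp
qed

text \<open>As \<open>E\<close> fixes \<open>a\<close> and kills \<open>d = x - E x\<close>, it
  sends \<open>t a + d\<close> to \<open>t a\<close>. In \<open>square_contraction\<close> the
  \<open>t\<^sup>2\<close> terms cancel, and the cross term, linear in \<open>t\<close>, must
  vanish.\<close>

lemma orthogonal:
  assumes x: "x \<in> M" "selfadj x" and a: "a \<in> N" "selfadj a"
  shows "Re (\<psi> ((a o\<^sub>L (x - E x)) + ((x - E x) o\<^sub>L a))) = 0"
proof (rule linear_term_zero)
  fix t :: real
  define d where "d = x - E x"
  have mem: "E x \<in> M" "a \<in> M" "d \<in> M"
    unfolding d_def using x a E_in[OF x(1)] N_sub by (auto intro!: MA)
  have d: "selfadj d" "E d = 0"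
    using x mem by (auto simp: d_def E_diff E_fix E_in intro!: selfadj_diff E_selfadj)
  have "E (t *\<^sub>R a + d) = t *\<^sub>R a"
    using mem a by (simp add: E_add E_scaleR E_fix d MA)
  then have "Re (\<psi> (t *\<^sub>R a o\<^sub>L t *\<^sub>R a)) \<le> Re (\<psi> ((t *\<^sub>R a + d) o\<^sub>L (t *\<^sub>R a + d)))"
    using square_contraction[of "t *\<^sub>R a + d"] mem a d by (simp add: MA selfadj_add selfadj_scaleR)
  also have "(t *\<^sub>R a + d) o\<^sub>L (t *\<^sub>R a + d)
      = (t *\<^sub>R a o\<^sub>L t *\<^sub>R a) + (t *\<^sub>R ((a o\<^sub>L d) + (d o\<^sub>L a)) + (d o\<^sub>L d))"
    by (simp add: compose_simps algebra_simps)
  also have "\<psi> \<dots> = \<psi> (t *\<^sub>R a o\<^sub>L t *\<^sub>R a) + (complex_of_real t * \<psi> ((a o\<^sub>L d) + (d o\<^sub>L a)) + \<psi> (d o\<^sub>L d))"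
    using mem by (simp add: \<psi>_add \<psi>_scaleR MA)
  finally show "0 \<le> t * Re (\<psi> ((a o\<^sub>L (x - E x)) + ((x - E x) o\<^sub>L a))) + Re (\<psi> (d o\<^sub>L d))"
    by (simp add: d_def)
qed

end

section \<open>The tower property\<close>

theorem corollary5p6:
  fixes M :: "'h::complex_hilbert_space operator set"
    and N :: "real \<Rightarrow> 'h operator set"
    and T :: real
    and \<psi> :: "'h operator \<Rightarrow> complex"
    and \<pi> :: "'h operator \<Rightarrow> 'k::complex_hilbert_space operator"
    and \<Omega> :: 'k
    and E :: "real \<Rightarrow> 'h operator \<Rightarrow> 'h operator"
  assumes "von_neumann_algebra M"
    and "\<forall>t\<in>{0..T}. von_neumann_subalgebra (N t) M \<and> abelian (N t)"
    and "\<forall>s\<in>{0..T}. \<forall>t\<in>{0..T}. s \<le> t \<longrightarrow> N s \<subseteq> N t"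
    and "state M \<psi>" and "faithful M \<psi>" and "normal_functional M \<psi>"
    and "gns_triple M \<psi> \<pi> \<Omega>"
    and "\<forall>t\<in>{0..T}. \<forall>s. modular_automorphism M \<pi> \<Omega> s ` N t = N t"
    and "\<forall>t\<in>{0..T}. conditional_expectation M (N t) (E t) \<and>
           normal_map M (N t) (E t) \<and> preserving M \<psi> (E t)"
  shows "\<forall>s t. 0 \<le> s \<and> s \<le> t \<and> t \<le> T \<longrightarrow> (\<forall>x\<in>M. E s (E t x) = E s x)"
proof (intro allI impI ballI)
  fix s t x
  assume st: "0 \<le> s \<and> s \<le> t \<and> t \<le> T" and x: "x \<in> M"
  have loc: "preserving_expectation M (N r) (E r) \<psi>" if "r \<in> {0..T}" for r
    using assms that by unfold_locales auto
  interpret s: preserving_expectation M "N s" "E s" \<psi> using st by (intro loc) auto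
  interpret t: preserving_expectation M "N t" "E t" \<psi> using st by (intro loc) auto
  have sub: "N s \<subseteq> N t" using assms(3) st by auto
  have tM: "E t y \<in> M" if "y \<in> M" for y using t.E_in[OF that] t.N_sub by auto
  have sM: "E s y \<in> M" if "y \<in> M" for y using s.E_in[OF that] s.N_sub by auto
  have sa_case: "E s (E t y) = E s y" if y: "y \<in> M" "selfadj y" for y
  proof -
    define a where "a = E s (E t y) - E s y"
    have "a \<in> N s"
      unfolding a_def using y by (intro s.NA s.E_in tM)
    moreover have "selfadj a"
      unfolding a_def using y by (intro selfadj_diff s.E_selfadj t.E_selfadj tM)
    ultimately have a: "a \<in> N s" "a \<in> N t" "a \<in> M" "selfadj a"
      using sub s.N_sub by auto
    \<comment> \<open>Twice the real inner product with \<open>a\<close>.\<close>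
    define J where "J d = Re (\<psi> ((a o\<^sub>L d) + (d o\<^sub>L a)))" for d
    have J_add: "J (d + e) = J d + J e" if "d \<in> M" "e \<in> M" for d e
      using that a by (simp add: J_def compose_simps s.\<psi>_add s.MA)
    \<comment> \<open>\<open>a\<close> lies in both subalgebras, so it is orthogonal to the
      residuals of \<open>E s\<close> at \<open>y\<close> and at \<open>E t y\<close>, and to that
      of \<open>E t\<close> at \<open>y\<close>.\<close>
    have zero: "J (y - E s y) = 0" "J (E t y - E s (E t y)) = 0" "J (y - E t y) = 0"
      using y a tM unfolding J_def
      by (auto intro!: s.orthogonal t.orthogonal t.E_selfadj)
    have "J (y - E s y) = J ((y - E t y) + ((E t y - E s (E t y)) + a))"
      by (simp add: a_def)
    also have "\<dots> = J (y - E t y) + (J (E t y - E s (E t y)) + J a)"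
      by (simp only: J_add s.MA tM sM y a)
    finally have "J a = 0" using zero by simp
    then have "Re (\<psi> (a o\<^sub>L a)) = 0"
      using a by (simp add: J_def s.\<psi>_add s.MA)
    moreover have "adj a = a"
      using a s.M_bounded by (intro adj_selfadj) auto
    \<comment> \<open>Only the real part is known to vanish so far; a state is real on such
      squares.\<close>
    moreover have "\<psi> (adj a o\<^sub>L a) \<in> \<real>"
      using assms(4) a by (auto simp: state_def)
    ultimately have "\<psi> (adj a o\<^sub>L a) = 0"
      by (simp add: complex_is_Real_iff complex_eq_iff)
    then have "a = 0" using assms(5) a by (auto simp: faithful_def)
    then show ?thesis by (simp add: a_def)
  qed
  obtain a b where ab: "a \<in> M" "b \<in> M" "selfadj a" "selfadj b" "x = a + scaleC_op \<i> b"
    using selfadj_decomposition[OF assms(1) x] by blast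
  have "scaleC_op \<i> z \<in> M" if "z \<in> M" for z
    by (rule von_neumann_algebra_scaleC[OF assms(1) that])
  then show "E s (E t x) = E s x"
    using ab sa_case tM by (simp add: s.E_add t.E_add s.E_scaleC t.E_scaleC)
qed

end
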